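(* At any equilibrium of the interconnected microgrid system described in the context (network and loads, inverters, frequency control, DC voltage control, output voltage control and secondary control $\dot\chi=-\alpha\mathcal{L}\chi+\alpha\mathcal{L}k_I\delta$), the first components $i^*_{oD,j}=\mathbf{e}^\top i^*_{o,j}$ of the equilibrium inverter output currents, assumed nonzero so that the ratios make sense, satisfy $$\frac{i^*_{oD,j}}{i^*_{oD,k}}=\frac{k_{p,k}}{k_{p,j}}\qquad\text{for all } j,k\in N.$$
   Context: Notation. $\mathbf{e}=[1\ 0]^\top$, $\mathbf{e}_2=\begin{bmatrix}0&1\\0&0\end{bmatrix}$, $J=\begin{bmatrix}0&1\\-1&0\end{bmatrix}$, $T(\delta)=\begin{bmatrix}\cos\delta&-\sin\delta\\ \sin\delta&\cos\delta\end{bmatrix}$, $\otimes$ is the Kronecker product. The network is a connected graph $(N,E)$ with $N=\{1,\dots,n\}$ the buses and $E$ the lines, with (oriented) incidence matrix $\mathcal{B}\in\mathbb{R}^{n\times|E|}$ and Laplacian $\mathcal{L}=\mathcal{B}\mathcal{B}^\top$. Set $\mathbf{B}=\mathcal{B}\otimes\mathbf{I}_2$ and $\mathbf{J}=$ block-diagonal matrix with blocks $J$ (of the size required). Parameters (all positive reals): $\omega_0,V_n,\alpha,v_{dc,r}$; line parameters $R_{jk},L_{jk}$ for each line; and for each bus $j$: $C_j,G_j,R_{\ell_j},L_{\ell_j}$, $C_{dc_j},G_{dc_j},R_{f_j},L_{f_j},C_{f_j},G_{s_j},R_{c_j},L_{c_j}$, and gains $k_{p,j},k_{I,j},n_{q,j},c_{p,j},c_{I,j},\lambda_{P,j},\lambda_{I,j},\Lambda_{P,j},\Lambda_{I,j}$.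 Write $k_I=\mathrm{diag}(k_{I,j})$, $R_l=\mathrm{diag}(R_{jk})\otimes\mathbf{I}_2$, $L_l=\mathrm{diag}(L_{jk})\otimes\mathbf{I}_2$, $C_l=\mathrm{diag}(C_j)\otimes\mathbf{I}_2$, $G_l=\mathrm{diag}(G_j)\otimes\mathbf{I}_2$, $R_\ell=\mathrm{diag}(R_{\ell_j})\otimes\mathbf{I}_2$, $L_\ell=\mathrm{diag}(L_{\ell_j})\otimes\mathbf{I}_2$. Interconnected microgrid system. $V_b,I_o,I_\ell\in\mathbb{R}^{2n}$ stack the two-dimensional vectors $v_{b,j},i_{o,j},i_{\ell,j}$ and $I_l\in\mathbb{R}^{2|E|}$ stacks line currents. Network and loads: $$C_l\dot V_b=(-G_l+\omega_0C_l\mathbf{J})V_b+I_o-I_\ell-\mathbf{B}I_l,\quad L_l\dot I_l=(-R_l+\omega_0L_l\mathbf{J})I_l+\mathbf{B}^\top V_b,\quad L_\ell\dot I_\ell=(-R_\ell+\omega_0L_\ell\mathbf{J})I_\ell+V_b.$$ Inverter at each bus $j$ (scalars $\delta_j,v_{dc,j},\zeta_j$; vectors $i_j,v_{o,j},i_{o,j},\beta_j,\xi_j\in\mathbb{R}^2$): $$\dot\delta_j=\omega_j-\omega_0,\quad C_{dc_j}\dot v_{dc,j}=-G_{dc_j}v_{dc,j}+i_{dc,j}-\tfrac12i_j^\top m_j,\quad L_{f_j}\dot i_j=(-R_{f_j}\mathbf{I}_2+\omega_0L_{f_j}J)i_j+\tfrac12v_{dc,j}m_j-v_{o,j},$$ $$C_{f_j}\dot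 v_{o,j}=(-G_{s_j}\mathbf{I}_2+\omega_0C_{f_j}J)v_{o,j}+i_j-i_{o,j},\quad L_{c_j}\dot i_{o,j}=(-R_{c_j}\mathbf{I}_2+\omega_0L_{c_j}J)i_{o,j}+v_{o,j}-v_{b,j}.$$ Controllers: $\omega_j=\omega_0-k_{p,j}\mathbf{e}^\top i_{o,j}-k_{I,j}\delta_j+\chi_j$; $\dot\zeta_j=v_{dc,j}-v_{dc,r}$, $i_{dc,j}=-\Lambda_{P,j}(v_{dc,j}-v_{dc,r})-\Lambda_{I,j}\zeta_j$; with $w_j=v_{o,j}-T(\delta_j)\mathbf{e}V_n-n_{q,j}\mathbf{e}_2i_{o,j}$: $\dot\beta_j=w_j$, $i^r_j=-c_{p,j}w_j-c_{I,j}\beta_j$, $\dot\xi_j=i_jv_{dc,r}-i^r_jv_{dc,j}$, $m_j=-\lambda_{P,j}(i_jv_{dc,r}-i^r_jv_{dc,j})-\lambda_{I,j}\xi_j$; and the secondary control $\dot\chi=-\alpha\mathcal{L}\chi+\alpha\mathcal{L}k_I\delta$ with $\chi=(\chi_j)$, $\delta=(\delta_j)$. An equilibrium is a constant solution; equilibrium values carry a superscript $*$. *)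

theory Defs
  imports "Graph_Theory.Digraph_Component" "HOL-Analysis.Analysis"
begin

text \<open>Buses are the elements of a finite type \<open>'n\<close>. A line is an ordered pair of buses, the order
  being the orientation used by the incidence matrix; lines form a set rather than a type, so that
  a single bus without lines is included.\<close>

record 'n microgrid =
  lines :: "('n \<times> 'n) set"
  omega0 :: real
  V_n :: real
  alpha :: real
  v_dcr :: real
  R_line :: "'n \<times> 'n \<Rightarrow> real"
  L_line :: "'n \<times> 'n \<Rightarrow> real"
  C_bus :: "'n \<Rightarrow> real"
  G_bus :: "'n \<Rightarrow> real"
  R_load :: "'n \<Rightarrow> real"
  L_load :: "'n \<Rightarrow> real"
  C_dc :: "'n \<Rightarrow> real"
  G_dc :: "'n \<Rightarrow> real"
  R_f :: "'n \<Rightarrow> real"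
  L_f :: "'n \<Rightarrow> real"
  C_f :: "'n \<Rightarrow> real"
  G_s :: "'n \<Rightarrow> real"
  R_c :: "'n \<Rightarrow> real"
  L_c :: "'n \<Rightarrow> real"
  k_p :: "'n \<Rightarrow> real"
  k_I :: "'n \<Rightarrow> real"
  n_q :: "'n \<Rightarrow> real"
  c_p :: "'n \<Rightarrow> real"
  c_I :: "'n \<Rightarrow> real"
  lambda_P :: "'n \<Rightarrow> real"
  lambda_I :: "'n \<Rightarrow> real"
  Lambda_P :: "'n \<Rightarrow> real"
  Lambda_I :: "'n \<Rightarrow> real"

definition network :: "'n microgrid \<Rightarrow> ('n, 'n \<times> 'n) pre_digraph" where
  "network P = \<lparr> verts = UNIV, arcs = lines P, tail = fst, head = snd \<rparr>"

definition positive_parameters :: "'n microgrid \<Rightarrow> bool" where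
  "positive_parameters P \<longleftrightarrow>
     omega0 P > 0 \<and> V_n P > 0 \<and> alpha P > 0 \<and> v_dcr P > 0 \<and>
     (\<forall>e \<in> lines P. R_line P e > 0 \<and> L_line P e > 0) \<and>
     (\<forall>j. C_bus P j > 0 \<and> G_bus P j > 0 \<and> R_load P j > 0 \<and> L_load P j > 0 \<and>
          C_dc P j > 0 \<and> G_dc P j > 0 \<and> R_f P j > 0 \<and> L_f P j > 0 \<and> C_f P j > 0 \<and>
          G_s P j > 0 \<and> R_c P j > 0 \<and> L_c P j > 0 \<and>
          k_p P j > 0 \<and> k_I P j > 0 \<and> n_q P j > 0 \<and> c_p P j > 0 \<and> c_I P j > 0 \<and>
          lambda_P P j > 0 \<and> lambda_I P j > 0 \<and> Lambda_P P j > 0 \<and> Lambda_I P j > 0)"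

text \<open>Asymmetry of the line set makes the network a simple graph: it has no loops, and each
  edge is represented by one of its two orientations only. Connectedness in
  \<^theory>\<open>Graph_Theory.Digraph_Component\<close> ignores the orientation.\<close>

definition microgrid :: "'n microgrid \<Rightarrow> bool" where
  "microgrid P \<longleftrightarrow>
     asym (lines P) \<and> Digraph_Component.connected (network P) \<and> positive_parameters P"

definition incidence :: "'n microgrid \<Rightarrow> 'n \<Rightarrow> 'n \<times> 'n \<Rightarrow> real" where
  "incidence P j e =
     (if j = tail (network P) e then 1 else if j = head (network P) e then -1 else 0)"

text \<open>The \<open>(j, k)\<close> entry of the incidence matrix times its transpose.\<close>

definition laplacian :: "'n::finite microgrid \<Rightarrow> real^'n^'n" where
  "laplacian P = (\<chi> j k. \<Sum>e\<in>lines P. incidence P j e * incidence P k e)"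

definition diag :: "('n::finite \<Rightarrow> real) \<Rightarrow> real^'n^'n" where
  "diag d = (\<chi> j k. if j = k then d j else 0)"

definition e_vec :: "real^2" where
  "e_vec = vector [1, 0]"

definition e2_mat :: "real^2^2" where
  "e2_mat = vector [vector [0, 1], vector [0, 0]]"

definition J_mat :: "real^2^2" where
  "J_mat = vector [vector [0, 1], vector [-1, 0]]"

definition T_mat :: "real \<Rightarrow> real^2^2" where
  "T_mat d = vector [vector [cos d, - sin d], vector [sin d, cos d]]"

record 'n state =
  v_bus :: "real^2^'n"
  i_line :: "'n \<times> 'n \<Rightarrow> real^2"
  i_load :: "real^2^'n"
  delta :: "real^'n"
  v_dc :: "real^'n"
  zeta :: "real^'n"
  i_inv :: "real^2^'n"
  v_out :: "real^2^'n"
  i_out :: "real^2^'n"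
  beta :: "real^2^'n"
  xi :: "real^2^'n"
  chi :: "real^'n"

definition omega :: "'n::finite microgrid \<Rightarrow> 'n state \<Rightarrow> 'n \<Rightarrow> real" where
  "omega P x j =
     omega0 P - k_p P j * (e_vec \<bullet> i_out x $ j) - k_I P j * delta x $ j + chi x $ j"

definition i_dc :: "'n::finite microgrid \<Rightarrow> 'n state \<Rightarrow> 'n \<Rightarrow> real" where
  "i_dc P x j = - Lambda_P P j * (v_dc x $ j - v_dcr P) - Lambda_I P j * zeta x $ j"

definition w_err :: "'n::finite microgrid \<Rightarrow> 'n state \<Rightarrow> 'n \<Rightarrow> real^2" where
  "w_err P x j =
     v_out x $ j - V_n P *\<^sub>R (T_mat (delta x $ j) *v e_vec) - n_q P j *\<^sub>R (e2_mat *v (i_out x $ j))"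

definition i_ref :: "'n::finite microgrid \<Rightarrow> 'n state \<Rightarrow> 'n \<Rightarrow> real^2" where
  "i_ref P x j = - c_p P j *\<^sub>R w_err P x j - c_I P j *\<^sub>R beta x $ j"

definition xi_rate :: "'n::finite microgrid \<Rightarrow> 'n state \<Rightarrow> 'n \<Rightarrow> real^2" where
  "xi_rate P x j = v_dcr P *\<^sub>R i_inv x $ j - v_dc x $ j *\<^sub>R i_ref P x j"

definition m_mod :: "'n::finite microgrid \<Rightarrow> 'n state \<Rightarrow> 'n \<Rightarrow> real^2" where
  "m_mod P x j = - lambda_P P j *\<^sub>R xi_rate P x j - lambda_I P j *\<^sub>R xi x $ j"

text \<open>In the following, \<open>x\<close> is the current state and \<open>x'\<close> its time derivative.

  The network and load equations are written one two-dimensional block at a time. In particular,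
  with \<open>B\<close> the incidence matrix and \<open>\<otimes>\<close> the Kronecker product, block \<open>j\<close> of
  \<open>(B \<otimes> I\<^sub>2) I\<^sub>l\<close> and block \<open>e\<close> of \<open>(B \<otimes> I\<^sub>2)\<^sup>T V\<^sub>b\<close> are the sums below over the lines and over
  the buses, respectively.\<close>

definition network_equations :: "'n::finite microgrid \<Rightarrow> 'n state \<Rightarrow> 'n state \<Rightarrow> bool" where
  "network_equations P x x' \<longleftrightarrow>
     (\<forall>j. C_bus P j *\<^sub>R v_bus x' $ j =
            (- G_bus P j *\<^sub>R mat 1 + (omega0 P * C_bus P j) *\<^sub>R J_mat) *v (v_bus x $ j)
            + i_out x $ j - i_load x $ j - (\<Sum>e\<in>lines P. incidence P j e *\<^sub>R i_line x e)) \<and>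
     (\<forall>e\<in>lines P. L_line P e *\<^sub>R i_line x' e =
            (- R_line P e *\<^sub>R mat 1 + (omega0 P * L_line P e) *\<^sub>R J_mat) *v i_line x e
            + (\<Sum>j\<in>UNIV. incidence P j e *\<^sub>R v_bus x $ j)) \<and>
     (\<forall>j. L_load P j *\<^sub>R i_load x' $ j =
            (- R_load P j *\<^sub>R mat 1 + (omega0 P * L_load P j) *\<^sub>R J_mat) *v (i_load x $ j)
            + v_bus x $ j)"

definition inverter_equations :: "'n::finite microgrid \<Rightarrow> 'n state \<Rightarrow> 'n state \<Rightarrow> 'n \<Rightarrow> bool" where
  "inverter_equations P x x' j \<longleftrightarrow>
     delta x' $ j = omega P x j - omega0 P \<and>
     C_dc P j * v_dc x' $ j =
       - G_dc P j * v_dc x $ j + i_dc P x j - 1/2 * (i_inv x $ j \<bullet> m_mod P x j) \<and>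
     L_f P j *\<^sub>R i_inv x' $ j =
       (- R_f P j *\<^sub>R mat 1 + (omega0 P * L_f P j) *\<^sub>R J_mat) *v (i_inv x $ j)
       + (1/2 * v_dc x $ j) *\<^sub>R m_mod P x j - v_out x $ j \<and>
     C_f P j *\<^sub>R v_out x' $ j =
       (- G_s P j *\<^sub>R mat 1 + (omega0 P * C_f P j) *\<^sub>R J_mat) *v (v_out x $ j)
       + i_inv x $ j - i_out x $ j \<and>
     L_c P j *\<^sub>R i_out x' $ j =
       (- R_c P j *\<^sub>R mat 1 + (omega0 P * L_c P j) *\<^sub>R J_mat) *v (i_out x $ j)
       + v_out x $ j - v_bus x $ j"

definition controller_equations :: "'n::finite microgrid \<Rightarrow> 'n state \<Rightarrow> 'n state \<Rightarrow> 'n \<Rightarrow> bool" where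
  "controller_equations P x x' j \<longleftrightarrow>
     zeta x' $ j = v_dc x $ j - v_dcr P \<and>
     beta x' $ j = w_err P x j \<and>
     xi x' $ j = xi_rate P x j"

definition secondary_control :: "'n::finite microgrid \<Rightarrow> 'n state \<Rightarrow> 'n state \<Rightarrow> bool" where
  "secondary_control P x x' \<longleftrightarrow>
     chi x' = - (alpha P *\<^sub>R (laplacian P *v chi x))
              + alpha P *\<^sub>R (laplacian P *v (diag (k_I P) *v delta x))"

definition microgrid_equations :: "'n::finite microgrid \<Rightarrow> 'n state \<Rightarrow> 'n state \<Rightarrow> bool" where
  "microgrid_equations P x x' \<longleftrightarrow>
     network_equations P x x' \<and>
     (\<forall>j. inverter_equations P x x' j \<and> controller_equations P x x' j) \<and>
     secondary_control P x x'"

definition has_state_derivative ::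
    "'n::finite microgrid \<Rightarrow> (real \<Rightarrow> 'n state) \<Rightarrow> 'n state \<Rightarrow> real \<Rightarrow> bool" where
  "has_state_derivative P X x' t \<longleftrightarrow>
     ((\<lambda>s. v_bus (X s)) has_vector_derivative v_bus x') (at t) \<and>
     (\<forall>e\<in>lines P. ((\<lambda>s. i_line (X s) e) has_vector_derivative i_line x' e) (at t)) \<and>
     ((\<lambda>s. i_load (X s)) has_vector_derivative i_load x') (at t) \<and>
     ((\<lambda>s. delta (X s)) has_vector_derivative delta x') (at t) \<and>
     ((\<lambda>s. v_dc (X s)) has_vector_derivative v_dc x') (at t) \<and>
     ((\<lambda>s. zeta (X s)) has_vector_derivative zeta x') (at t) \<and>
     ((\<lambda>s. i_inv (X s)) has_vector_derivative i_inv x') (at t) \<and>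
     ((\<lambda>s. v_out (X s)) has_vector_derivative v_out x') (at t) \<and>
     ((\<lambda>s. i_out (X s)) has_vector_derivative i_out x') (at t) \<and>
     ((\<lambda>s. beta (X s)) has_vector_derivative beta x') (at t) \<and>
     ((\<lambda>s. xi (X s)) has_vector_derivative xi x') (at t) \<and>
     ((\<lambda>s. chi (X s)) has_vector_derivative chi x') (at t)"

definition solution :: "'n::finite microgrid \<Rightarrow> (real \<Rightarrow> 'n state) \<Rightarrow> bool" where
  "solution P X \<longleftrightarrow>
     (\<forall>t. \<exists>x'. has_state_derivative P X x' t \<and> microgrid_equations P (X t) x')"

definition equilibrium :: "'n::finite microgrid \<Rightarrow> 'n state \<Rightarrow> bool" where
  "equilibrium P x \<longleftrightarrow> solution P (\<lambda>t. x)"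

end

theory Submission
  imports Defs
begin

text \<open>The frequency control and the secondary control together fix the sharing ratios. At an
  equilibrium \<open>\<delta>\<close> is constant, so \<open>\<omega>\<^sub>j = \<omega>\<^sub>0\<close> and the frequency control reads
  \<open>k\<^sub>p\<^sub>,\<^sub>j i\<^sub>o\<^sub>D\<^sub>,\<^sub>j = \<chi>\<^sub>j - k\<^sub>I\<^sub>,\<^sub>j \<delta>\<^sub>j\<close>. Since \<open>\<chi>\<close> is constant too and \<open>\<alpha> > 0\<close>, the secondary control
  puts the vector \<open>\<chi> - k\<^sub>I \<delta>\<close> of right-hand sides into the kernel of the Laplacian. On a
  connected graph this kernel consists of the constant vectors: the quadratic form of the
  Laplacian is the sum over the lines of the squared differences between the two end buses
  (\<open>inner_laplacian\<close>), so a vector in the kernel does not change along any line, and connectedness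
  makes it constant (\<open>laplacian_kernel_constant\<close>). Hence \<open>k\<^sub>p\<^sub>,\<^sub>j i\<^sub>o\<^sub>D\<^sub>,\<^sub>j\<close> is the same at every bus.\<close>

text \<open>A path in the underlying undirected graph traverses each arc forwards or backwards, and the
  value is preserved in both directions.\<close>

lemma connected_imp_constant:
  assumes "Digraph_Component.connected G"
    and arc: "\<And>e. e \<in> arcs G \<Longrightarrow> f (tail G e) = f (head G e)"
    and "u \<in> verts G" "v \<in> verts G"
  shows "f u = f v"
proof -
  have "reachable (with_proj (mk_symmetric G)) u v"
    using assms by (auto simp: Digraph_Component.connected_def strongly_connected_def)
  then have "(u, v) \<in> (parcs (mk_symmetric G))\<^sup>*"
    using reachable_rtranclI by fastforce
  then show ?thesis
    by induction (auto simp: parcs_mk_symmetric arc)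
qed

lemma sum_incidence:
  fixes P :: "'n::finite microgrid" and u :: "real^'n"
  assumes "asym (lines P)" and "e \<in> lines P"
  shows "(\<Sum>j\<in>UNIV. incidence P j e * u $ j) = u $ fst e - u $ snd e"
proof -
  \<comment> \<open>For a loop, the definition of the incidence matrix would yield \<open>1\<close> in place of \<open>1 - 1 = 0\<close>.\<close>
  have no_loop: "fst e \<noteq> snd e"
    using assms by (metis asymD prod.collapse)
  have "(\<Sum>j\<in>UNIV. incidence P j e * u $ j)
      = (\<Sum>j\<in>UNIV. (if j = fst e then u $ j else 0) - (if j = snd e then u $ j else 0))"
    by (rule sum.cong) (use no_loop in \<open>auto simp: incidence_def network_def\<close>)
  then show ?thesis
    by (simp add: sum_subtractf)
qed

text \<open>As the Laplacian is the incidence matrix times its transpose, its quadratic form is the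
  squared norm of the transposed incidence matrix applied to the vector.\<close>

lemma inner_laplacian:
  fixes P :: "'n::finite microgrid" and u :: "real^'n"
  assumes "asym (lines P)"
  shows "u \<bullet> (laplacian P *v u) = (\<Sum>e\<in>lines P. (u $ fst e - u $ snd e)\<^sup>2)"
proof -
  have "u \<bullet> (laplacian P *v u)
      = (\<Sum>j\<in>UNIV. \<Sum>k\<in>UNIV. \<Sum>e\<in>lines P. (incidence P j e * u $ j) * (incidence P k e * u $ k))"
    by (simp add: inner_vec_def matrix_vector_mult_def laplacian_def
        sum_distrib_left sum_distrib_right mult_ac)
  also have "\<dots> = (\<Sum>j\<in>UNIV. \<Sum>e\<in>lines P. \<Sum>k\<in>UNIV. (incidence P j e * u $ j) * (incidence P k e * u $ k))"
    by (rule sum.cong[OF refl]) (rule sum.swap)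
  also have "\<dots> = (\<Sum>e\<in>lines P. \<Sum>j\<in>UNIV. \<Sum>k\<in>UNIV. (incidence P j e * u $ j) * (incidence P k e * u $ k))"
    by (rule sum.swap)
  also have "\<dots> = (\<Sum>e\<in>lines P. (\<Sum>j\<in>UNIV. incidence P j e * u $ j)\<^sup>2)"
    by (simp add: power2_eq_square sum_product)
  also have "\<dots> = (\<Sum>e\<in>lines P. (u $ fst e - u $ snd e)\<^sup>2)"
    by (simp add: sum_incidence[OF assms])
  finally show ?thesis .
qed

lemma laplacian_kernel_constant:
  fixes P :: "'n::finite microgrid" and u :: "real^'n"
  assumes "asym (lines P)" and "Digraph_Component.connected (network P)"
    and "laplacian P *v u = 0"
  shows "u $ j = u $ k"
proof -
  have "(\<Sum>e\<in>lines P. (u $ fst e - u $ snd e)\<^sup>2) = 0"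
    using inner_laplacian[OF assms(1), of u] assms(3) by simp
  then have "\<forall>e\<in>lines P. (u $ fst e - u $ snd e)\<^sup>2 = 0"
    by (subst (asm) sum_nonneg_eq_0_iff) auto
  then show ?thesis
    using connected_imp_constant[OF assms(2), of "\<lambda>j. u $ j" j k]
    by (simp add: network_def)
qed

lemma equilibrium_frequency_and_secondary_control:
  assumes "equilibrium P x"
  shows "omega P x j = omega0 P"
    and "- (alpha P *\<^sub>R (laplacian P *v chi x))
           + alpha P *\<^sub>R (laplacian P *v (diag (k_I P) *v delta x)) = 0"
proof -
  obtain x' where der: "has_state_derivative P (\<lambda>t. x) x' 0" and eqs: "microgrid_equations P x x'"
    using assms unfolding equilibrium_def solution_def by blast
  have "delta x' = 0" "chi x' = 0"
    using der unfolding has_state_derivative_def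
    by (blast intro: vector_derivative_unique_at has_vector_derivative_const)+
  then show "omega P x j = omega0 P"
    and "- (alpha P *\<^sub>R (laplacian P *v chi x))
           + alpha P *\<^sub>R (laplacian P *v (diag (k_I P) *v delta x)) = 0"
    using eqs
    by (auto simp: microgrid_equations_def inverter_equations_def secondary_control_def)
qed

lemma diag_mult_vec: "(diag d *v u) $ j = d j * u $ j"
  by (simp add: diag_def matrix_vector_mult_def if_distrib[of "\<lambda>a. a * _"] cong: if_cong)

theorem proposition2:
  fixes P :: "'n::finite microgrid" and x :: "'n state"
  assumes "microgrid P"
    and "equilibrium P x"
    and "\<forall>j. e_vec \<bullet> i_out x $ j \<noteq> 0"
  shows "\<forall>j k. (e_vec \<bullet> i_out x $ j) / (e_vec \<bullet> i_out x $ k) = k_p P k / k_p P j"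
proof (intro allI)
  fix j k
  define u where "u = chi x - diag (k_I P) *v delta x"
  have graph: "asym (lines P)" "Digraph_Component.connected (network P)"
    and "alpha P > 0" and k_p_pos: "\<And>i. k_p P i > 0"
    using assms(1) by (auto simp: microgrid_def positive_parameters_def)
  have u: "u $ i = k_p P i * (e_vec \<bullet> i_out x $ i)" for i
    using equilibrium_frequency_and_secondary_control(1)[OF assms(2), of i]
    by (simp add: u_def omega_def diag_mult_vec)
  have "alpha P *\<^sub>R (laplacian P *v u) = 0"
    using equilibrium_frequency_and_secondary_control(2)[OF assms(2)]
    by (auto simp: u_def matrix_vector_mult_diff_distrib scaleR_diff_right)
  then have "laplacian P *v u = 0"
    using \<open>alpha P > 0\<close> by simp
  then have "u $ j = u $ k"
    by (rule laplacian_kernel_constant[OF graph])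
  then have "k_p P j * (e_vec \<bullet> i_out x $ j) = k_p P k * (e_vec \<bullet> i_out x $ k)"
    by (simp add: u)
  then show "(e_vec \<bullet> i_out x $ j) / (e_vec \<bullet> i_out x $ k) = k_p P k / k_p P j"
    using assms(3) k_p_pos[of j] by (simp add: frac_eq_eq mult_ac)
qed

end
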